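(* Let $\Sigma$ be a finite alphabet, let $\mathcal{O}$ be the observation function given by projection onto a sub-alphabet $\Sigma_{ob}\subseteq\Sigma$, and let $\varphi\subseteq\Sigma^\omega$ be an $\omega$-regular predicate. Let $\mathcal{S}_1$ and $\mathcal{S}_2$ be IDTMC specifications over $\Sigma$ such that $\mathcal{S}_2$ simulates $\mathcal{S}_1$. Then $$\underline{Disc}(\mathcal{S}_1,\mathcal{O},\varphi)\le \underline{Disc}(\mathcal{S}_2,\mathcal{O},\varphi).$$
   Context: For a countable set $Z$, $\mathrm{Dist}(Z)$ is the set of discrete probability distributions on $Z$. Probabilistic transition system (PTS) over $\Sigma$: $\mathcal{A}=\langle Q,q_{init},\Delta,L\rangle$ with $Q$ countable, $q_{init}\in Q$, $\Delta:Q\to \mathrm{Dist}(Q)$ with each $\Delta(q)$ of finite support, and $L:Q\to\Sigma$. An infinite run is a sequence $q_0q_1\dots$ with $q_0=q_{init}$ and $\Delta(q_i)(q_{i+1})>0$ for all $i$; its trace is $L(q_0)L(q_1)\cdots$. $Tr(\mathcal{A})\subseteq\Sigma^\omega$ is the set of traces of infinite runs from $q_{init}$. $\mathbf{P}_{\mathcal{A}}$ is the usual probability measure on infinite runs generated by cones, with $\mathbf{P}_{\mathcal{A}}(C_{q_0\dots q_n})=\prod_{i<n}\Delta(q_i)(q_{i+1})$; the probability of a set of words is the probability of the set of runs whose trace is in it. IDTMC (Interval-valued Discrete Time Markov Chain): $\mathcal{S}=(S,s_{init},T,\lambda)$ with $S$ finite, $s_{init}\in S$, $T:S\to(S\to\mathcal{I})$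 where $\mathcal{I}$ is the set of intervals in $[0,1]$, and $\lambda:S\to\Sigma$. We write $f\in T(s)$ for any $f:S\to[0,1]$ with $f(s')\in T(s)(s')$ for all $s'\in S$ and $\sum_{s'\in S}f(s')=1$. A run of $\mathcal{S}$ is a sequence $s\xrightarrow{\mu_1}s_1\xrightarrow{\mu_2}\cdots$ where each $\mu_i\in \mathrm{Dist}(S)$ satisfies $\mu_i(s')\in T(s_{i-1})(s')$ for all $s'\in S$ (with $s_0=s$). $FRuns(\mathcal{S})$ is the set of finite runs starting from $s_{init}$, and $\mathrm{lst}(\rho)$ is the last state of $\rho$. Scheduler: a map $A:FRuns(\mathcal{S})\to \mathrm{Dist}(S)$ such that $A(\rho)(s')\in T(\mathrm{lst}(\rho))(s')$ for all $\rho$ and $s'$; $Sched(\mathcal{S})$ is the set of schedulers. Scheduling $\mathcal{S}$ with $A$ gives the PTS $\mathcal{S}(A)$ whose states are the finite runs $Q\subseteq FRuns(\mathcal{S})$ that can be generated by $A$ (obtained from $s_{init}$ by successively appending $\rho\xrightarrow{A(\rho)}s'$), with initial state the run $s_{init}$, $L(\rho)=\lambda(\mathrm{lst}(\rho))$, and $\Delta(\rho)(\rho')=A(\rho)(s')$ for $\rho'=\rho\xrightarrow{A(\rho)}s'$. Simulation: $\mathcal{S}_2=(S_2,s_{2,init},T_2,\lambda_2)$ simulates $\mathcal{S}_1=(S_1,s_{1,init},T_1,\lambda_1)$ if there is a relation $\mathcal{R}\subseteq S_1\times S_2$ with $s_{1,init}\,\mathcal{R}\,s_{2,init}$ and such that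 whenever $s_1\,\mathcal{R}\,s_2$: (1) $\lambda_1(s_1)=\lambda_2(s_2)$; (2) there exists a function $\delta:S_1\to \mathrm{Dist}(S_2)$ such that for all $f\in T_1(s_1)$ and $s_2'\in S_2$, $\sum_{s_1'\in S_1}f(s_1')\cdot\delta(s_1')(s_2')\in T_2(s_2)(s_2')$; (3) $s_1'\,\mathcal{R}\,s_2'$ whenever $\delta(s_1')(s_2')>0$. Observation: $\mathcal{O}:\Sigma^\omega\to\Sigma_{ob}^{*}\cup\Sigma_{ob}^{\omega}$ is the projection erasing all letters not in $\Sigma_{ob}$. Disclosure: for a PTS $\mathcal{A}$, $\mathcal{V}(\mathcal{A},\mathcal{O},\varphi)=(Tr(\mathcal{A})\cap\varphi)\setminus \mathcal{O}^{-1}(\mathcal{O}(Tr(\mathcal{A})\setminus\varphi))$ and $Disc(\mathcal{A},\mathcal{O},\varphi)=\mathbf{P}_{\mathcal{A}}(\mathcal{V}(\mathcal{A},\mathcal{O},\varphi))$. For an IDTMC, $\underline{Disc}(\mathcal{S},\mathcal{O},\varphi)=\sup_{A\in Sched(\mathcal{S})}Disc(\mathcal{S}(A),\mathcal{O},\varphi)$.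
   Formalization: The formal theorem additionally assumes that S2 has at least one scheduler (every state of S2 admits a distribution); without this the supremum for S2 is over the empty set and the claim fails for some S1 that S2 simulates. *)

theory Defs
  imports
    "HOL-Probability.Probability"
    "HOL-Library.Infinite_Set"
    "HOL-Library.Omega_Words_Fun"
begin

section \<open>Omega-regular predicates and observations\<close>

text \<open>
  Omega-words over the alphabet are functions \<^typ>\<open>nat \<Rightarrow> 'a\<close> (\<^typ>\<open>'a word\<close>).  A language is
  omega-regular if it is accepted by a nondeterministic Buechi automaton with finitely many states.
  HOL cannot quantify over types inside a formula, so automaton states are natural numbers, which
  is no restriction for finite state sets.
\<close>

definition buechi_lang ::
  "nat set \<Rightarrow> (nat \<times> 'a \<times> nat) set \<Rightarrow> nat set \<Rightarrow> 'a word set"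
  where "buechi_lang I E F =
    {w. \<exists>r. r 0 \<in> I \<and> (\<forall>n. (r n, w n, r (Suc n)) \<in> E) \<and> limit r \<inter> F \<noteq> {}}"

definition omega_regular :: "'a word set \<Rightarrow> bool"
  where "omega_regular L \<longleftrightarrow>
    (\<exists>Q I E F. finite Q \<and> I \<subseteq> Q \<and> E \<subseteq> Q \<times> UNIV \<times> Q \<and> F \<subseteq> Q \<and> L = buechi_lang I E F)"

text \<open>
  The projection erasing the letters outside \<^term>\<open>Ob\<close>; its value is a finite word (\<^const>\<open>Inl\<close>)
  if only finitely many positions survive, and an infinite word (\<^const>\<open>Inr\<close>) otherwise.
\<close>

definition obs :: "'a set \<Rightarrow> 'a word \<Rightarrow> 'a list + 'a word"
  where "obs Ob w =
    (let I = {i. w i \<in> Ob} in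
     if finite I then Inl (map w (sorted_list_of_set I)) else Inr (w \<circ> enumerate I))"


section \<open>Probabilistic transition systems\<close>

record ('q, 'a) pts =
  states :: "'q set"
  start :: 'q
  step :: "'q \<Rightarrow> 'q pmf"
  label :: "'q \<Rightarrow> 'a"

definition is_pts :: "('q, 'a) pts \<Rightarrow> bool"
  where "is_pts A \<longleftrightarrow> countable (states A) \<and> start A \<in> states A \<and>
    (\<forall>q\<in>states A. finite (set_pmf (step A q)) \<and> set_pmf (step A q) \<subseteq> states A)"

definition runs :: "('q, 'a) pts \<Rightarrow> (nat \<Rightarrow> 'q) set"
  where "runs A = {r. r 0 = start A \<and> (\<forall>i. r i \<in> states A) \<and>
    (\<forall>i. pmf (step A (r i)) (r (Suc i)) > 0)}"

definition finite_runs :: "('q, 'a) pts \<Rightarrow> 'q list set"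
  where "finite_runs A = {qs. qs \<noteq> [] \<and> hd qs = start A \<and> set qs \<subseteq> states A \<and>
    (\<forall>i. Suc i < length qs \<longrightarrow> pmf (step A (qs ! i)) (qs ! Suc i) > 0)}"

definition trace :: "('q, 'a) pts \<Rightarrow> (nat \<Rightarrow> 'q) \<Rightarrow> 'a word"
  where "trace A r = label A \<circ> r"

definition Tr :: "('q, 'a) pts \<Rightarrow> 'a word set"
  where "Tr A = trace A ` runs A"

definition cone :: "('q, 'a) pts \<Rightarrow> 'q list \<Rightarrow> (nat \<Rightarrow> 'q) set"
  where "cone A qs = {r \<in> runs A. prefix (length qs) r = qs}"

definition cone_prob :: "('q, 'a) pts \<Rightarrow> 'q list \<Rightarrow> real"
  where "cone_prob A qs = (\<Prod>i<length qs - 1. pmf (step A (qs ! i)) (qs ! Suc i))"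

text \<open>
  The measure on the infinite runs generated by the cones; that the cone probabilities do extend
  to a probability measure is proved below (\<open>emeasure_run_measure_cone\<close>,
  \<open>prob_space_run_measure\<close>).
\<close>

definition run_measure :: "('q, 'a) pts \<Rightarrow> (nat \<Rightarrow> 'q) measure"
  where "run_measure A =
    extend_measure (runs A) (finite_runs A) (cone A) (\<lambda>qs. ennreal (cone_prob A qs))"

text \<open>
  The set of runs is measured in the completion of \<^const>\<open>run_measure\<close>: the runs disclosing a
  secret form in general a co-analytic set, which is measurable for the completion but need not
  belong to the sigma-algebra generated by the cones, and \<^const>\<open>emeasure\<close> is \<open>0\<close> outside the
  sigma-algebra.
\<close>

definition word_prob :: "('q, 'a) pts \<Rightarrow> 'a word set \<Rightarrow> ennreal"
  where "word_prob A W = emeasure (completion (run_measure A)) {r \<in> runs A. trace A r \<in> W}"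

definition disclosing :: "('q, 'a) pts \<Rightarrow> ('a word \<Rightarrow> 'o) \<Rightarrow> 'a word set \<Rightarrow> 'a word set"
  where "disclosing A O' \<phi> = (Tr A \<inter> \<phi>) - O' -` (O' ` (Tr A - \<phi>))"

definition Disc :: "('q, 'a) pts \<Rightarrow> ('a word \<Rightarrow> 'o) \<Rightarrow> 'a word set \<Rightarrow> ennreal"
  where "Disc A O' \<phi> = word_prob A (disclosing A O' \<phi>)"


section \<open>Interval-valued discrete-time Markov chains\<close>

record ('s, 'a) idtmc =
  init :: 's
  trans :: "'s \<Rightarrow> 's \<Rightarrow> real set"
  lab :: "'s \<Rightarrow> 'a"

text \<open>The state set is the whole type \<^typ>\<open>'s\<close>, which is finite.\<close>

definition is_idtmc :: "('s::finite, 'a) idtmc \<Rightarrow> bool"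
  where "is_idtmc S \<longleftrightarrow> (\<forall>s s'. is_interval (trans S s s') \<and> trans S s s' \<subseteq> {0..1})"

definition dists :: "('s::finite, 'a) idtmc \<Rightarrow> 's \<Rightarrow> ('s \<Rightarrow> real) set"
  where "dists S s = {f. (\<forall>s'. f s' \<in> {0..1} \<and> f s' \<in> trans S s s') \<and> (\<Sum>s'\<in>UNIV. f s') = 1}"

datatype 's frun = Init 's | Ext "'s frun" "'s pmf" 's

primrec lst :: "'s frun \<Rightarrow> 's" where
  "lst (Init s) = s"
| "lst (Ext \<rho> \<mu> s) = s"

inductive_set FRuns :: "('s::finite, 'a) idtmc \<Rightarrow> 's frun set" for S where
  "Init (init S) \<in> FRuns S"
| "\<rho> \<in> FRuns S \<Longrightarrow> (\<And>s'. pmf \<mu> s' \<in> trans S (lst \<rho>) s') \<Longrightarrow> Ext \<rho> \<mu> s \<in> FRuns S"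

text \<open>Schedulers are total functions here; their values outside \<^const>\<open>FRuns\<close> are irrelevant.\<close>

definition Sched :: "('s::finite, 'a) idtmc \<Rightarrow> ('s frun \<Rightarrow> 's pmf) set"
  where "Sched S = {A. \<forall>\<rho>\<in>FRuns S. \<forall>s'. pmf (A \<rho>) s' \<in> trans S (lst \<rho>) s'}"

inductive_set generated :: "('s::finite, 'a) idtmc \<Rightarrow> ('s frun \<Rightarrow> 's pmf) \<Rightarrow> 's frun set"
  for S A where
  "Init (init S) \<in> generated S A"
| "\<rho> \<in> generated S A \<Longrightarrow> Ext \<rho> (A \<rho>) s \<in> generated S A"

definition schedule :: "('s::finite, 'a) idtmc \<Rightarrow> ('s frun \<Rightarrow> 's pmf) \<Rightarrow> ('s frun, 'a) pts"
  where "schedule S A =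
    \<lparr>states = generated S A,
     start = Init (init S),
     step = (\<lambda>\<rho>. map_pmf (Ext \<rho> (A \<rho>)) (A \<rho>)),
     label = lab S \<circ> lst\<rparr>"

definition simulates :: "('t::finite, 'a) idtmc \<Rightarrow> ('s::finite, 'a) idtmc \<Rightarrow> bool"
  where "simulates S2 S1 \<longleftrightarrow>
    (\<exists>R :: 's \<Rightarrow> 't \<Rightarrow> bool. R (init S1) (init S2) \<and>
      (\<forall>s1 s2. R s1 s2 \<longrightarrow>
         lab S1 s1 = lab S2 s2 \<and>
         (\<exists>\<delta> :: 's \<Rightarrow> 't pmf.
            (\<forall>f\<in>dists S1 s1. \<forall>s2'. (\<Sum>s1'\<in>UNIV. f s1' * pmf (\<delta> s1') s2') \<in> trans S2 s2 s2') \<and>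
            (\<forall>s1' s2'. pmf (\<delta> s1') s2' > 0 \<longrightarrow> R s1' s2'))))"

text \<open>A supremum in \<^typ>\<open>ennreal\<close>, so that it is \<open>0\<close> if there is no scheduler.\<close>

definition Disc_sup :: "('s::finite, 'a) idtmc \<Rightarrow> ('a word \<Rightarrow> 'o) \<Rightarrow> 'a word set \<Rightarrow> ennreal"
  where "Disc_sup S O' \<phi> = (SUP A\<in>Sched S. Disc (schedule S A) O' \<phi>)"


section \<open>The definitions are well behaved\<close>

lemma generated_FRuns:
  assumes "A \<in> Sched S" "\<rho> \<in> generated S A"
  shows "\<rho> \<in> FRuns S"
  using assms(2)
proof induction
  case (2 \<rho> s)
  then show ?case using assms(1) by (auto simp: Sched_def intro!: FRuns.intros)
qed (rule FRuns.intros)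

lemma step_schedule: "pmf (step (schedule S A) \<rho>) (Ext \<rho> (A \<rho>) s) = pmf (A \<rho>) s"
  unfolding schedule_def by (simp add: pmf_map_inj' inj_def)

lemma countable_generated: "countable (generated S A)"
proof -
  define lev where "lev n = ((\<lambda>X. \<Union>\<rho>\<in>X. range (Ext \<rho> (A \<rho>))) ^^ n) {Init (init S)}" for n :: nat
  have fin: "finite (lev n)" for n
    by (induction n) (auto simp: lev_def)
  have "\<exists>n. \<rho> \<in> lev n" if "\<rho> \<in> generated S A" for \<rho>
    using that
  proof induction
    case 1
    show ?case by (rule exI[of _ 0]) (simp add: lev_def)
  next
    case (2 \<rho> s)
    then obtain n where "\<rho> \<in> lev n" by blast
    then have "Ext \<rho> (A \<rho>) s \<in> lev (Suc n)" by (auto simp: lev_def)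
    then show ?case ..
  qed
  then have "generated S A \<subseteq> (\<Union>n. lev n)" by blast
  moreover have "countable (\<Union>n. lev n)"
    using fin by (auto intro: countable_finite)
  ultimately show ?thesis by (rule countable_subset)
qed

lemma is_pts_schedule: "is_pts (schedule S A)"
  by (auto simp: is_pts_def schedule_def countable_generated intro: generated.intros)

text \<open>
  Schedulers exist exactly if every state admits some distribution: \<^const>\<open>FRuns\<close> does not
  require positive transition probabilities.
\<close>

lemma Sched_nonempty_iff: "Sched S \<noteq> {} \<longleftrightarrow> (\<forall>s. dists S s \<noteq> {})"
proof
  assume "Sched S \<noteq> {}"
  then obtain A where A: "A \<in> Sched S" by blast
  have "\<exists>\<rho>\<in>FRuns S. lst \<rho> = s" for s
  proof -
    have "Ext (Init (init S)) (A (Init (init S))) s \<in> FRuns S"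
      by (rule generated_FRuns[OF A]) (intro generated.intros)
    then show ?thesis by force
  qed
  moreover have "pmf (A \<rho>) \<in> dists S (lst \<rho>)" if "\<rho> \<in> FRuns S" for \<rho>
    using that A by (auto simp: dists_def Sched_def pmf_le_1 sum_pmf_eq_1)
  ultimately show "\<forall>s. dists S s \<noteq> {}" by (metis empty_iff)
next
  assume *: "\<forall>s. dists S s \<noteq> {}"
  have "\<exists>\<mu>. \<forall>s'. pmf \<mu> s' \<in> trans S s s'" for s
  proof -
    obtain f where f: "f \<in> dists S s" using * by blast
    then have "pmf (embed_pmf f) s' = f s'" for s'
      by (intro pmf_embed_pmf)
        (auto simp: dists_def nn_integral_count_space_finite simp flip: ennreal_1)
    with f show ?thesis by (intro exI[of _ "embed_pmf f"]) (auto simp: dists_def)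
  qed
  then obtain m where "\<And>s s'. pmf (m s) s' \<in> trans S s s'" by metis
  then have "(\<lambda>\<rho>. m (lst \<rho>)) \<in> Sched S" by (auto simp: Sched_def)
  then show "Sched S \<noteq> {}" by blast
qed

lemma ex_run_measure:
  assumes A: "is_pts A"
  obtains \<mu> where "prob_space \<mu>" "space \<mu> = runs A"
    "sets \<mu> = sigma_sets (runs A) (cone A ` finite_runs A)"
    "\<And>qs. qs \<in> finite_runs A \<Longrightarrow> emeasure \<mu> (cone A qs) = cone_prob A qs"
proof -
  text \<open>A run picks its successors from independent choices indexed by time and state.\<close>
  define M where "M = (\<lambda>(n::nat, q). measure_pmf (step A q))"
  interpret product_prob_space M UNIV
    by (intro product_prob_spaceI) (auto simp: M_def split: prod.split intro: prob_space_measure_pmf)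
  define fx where "fx q x = (if x \<in> set_pmf (step A q) then x else (SOME x. x \<in> set_pmf (step A q)))" for q x
  have fx_in: "fx q x \<in> set_pmf (step A q)" for q x
    using some_in_eq[of "set_pmf (step A q)"] set_pmf_not_empty[of "step A q"]
    by (auto simp: fx_def)
  define r where "r \<omega> = rec_nat (start A) (\<lambda>n q. fx q (\<omega> (n, q)))" for \<omega>
  have r0: "r \<omega> 0 = start A" and rS: "r \<omega> (Suc n) = fx (r \<omega> n) (\<omega> (n, r \<omega> n))" for \<omega> n
    by (simp_all add: r_def)
  have in_states: "r \<omega> n \<in> states A" for \<omega> n
  proof (induction n)
    case (Suc n)
    then show ?case using A fx_in[of "r \<omega> n" "\<omega> (n, r \<omega> n)"] by (auto simp: is_pts_def rS)
  qed (use A in \<open>auto simp: r0 is_pts_def\<close>)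
  have r_runs: "r \<omega> \<in> runs A" for \<omega>
    using in_states fx_in by (auto simp: runs_def r0 rS simp flip: set_pmf_iff pmf_positive_iff)
  let ?P = "PiM UNIV M"
  let ?emb = "\<lambda>qs. prod_emb UNIV M ((\<lambda>i. (i, qs ! i)) ` {..<length qs - 1})
     (PiE ((\<lambda>i. (i, qs ! i)) ` {..<length qs - 1}) (\<lambda>(i, q). fx q -` {qs ! Suc i}))"
  have vim: "r -` cone A qs \<inter> space ?P = ?emb qs" if qs: "qs \<in> finite_runs A" for qs
  proof -
    have "prefix (length qs) (r \<omega>) = qs \<longleftrightarrow> (\<forall>i<length qs - 1. fx (qs ! i) (\<omega> (i, qs ! i)) = qs ! Suc i)"
      (is "?L \<longleftrightarrow> ?R") for \<omega>
    proof
      assume L: ?L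
      have *: "r \<omega> i = qs ! i" if "i < length qs" for i
        using that by (subst L[symmetric]) simp
      show ?R
      proof (intro allI impI)
        fix i assume i: "i < length qs - 1"
        with *[of i] *[of "Suc i"] show "fx (qs ! i) (\<omega> (i, qs ! i)) = qs ! Suc i"
          by (simp add: rS)
      qed
    next
      assume R: ?R
      have "r \<omega> i = qs ! i" if "i < length qs" for i
        using that
      proof (induction i)
        case 0
        then show ?case using qs by (auto simp: r0 finite_runs_def hd_conv_nth)
      next
        case (Suc i)
        then have "r \<omega> i = qs ! i" "i < length qs - 1" by auto
        with R show ?case by (simp add: rS)
      qed
      then show ?L by (intro nth_equalityI) auto
    qed
    then show ?thesis
      by (auto simp: cone_def r_runs prod_emb_def space_PiM M_def split: prod.splits)
        (fastforce simp: PiE_iff)+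
  qed
  have emb_meas: "?emb qs \<in> sets ?P" for qs
    by (intro sets_PiM_I) (auto simp: M_def)
  define N where "N = sigma (runs A) (cone A ` finite_runs A)"
  have sub: "cone A ` finite_runs A \<subseteq> Pow (runs A)" by (auto simp: cone_def)
  have [measurable]: "r \<in> measurable ?P N"
    unfolding N_def
    using sub r_runs emb_meas by (intro measurable_measure_of) (auto simp: vim)
  define \<mu> where "\<mu> = distr ?P N r"
  have fixp: "emeasure (measure_pmf (step A q)) (fx q -` {q'}) = pmf (step A q) q'"
    if "pmf (step A q) q' > 0" for q q'
  proof -
    have "emeasure (measure_pmf (step A q)) (fx q -` {q'}) = emeasure (measure_pmf (step A q)) {q'}"
      by (intro emeasure_eq_AE) (auto simp: AE_measure_pmf_iff fx_def)
    then show ?thesis by (simp add: emeasure_pmf_single)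
  qed
  have em: "emeasure \<mu> (cone A qs) = cone_prob A qs" if qs: "qs \<in> finite_runs A" for qs
  proof -
    have "cone A qs \<in> sets N" using qs sub by (auto simp: N_def)
    then have "emeasure \<mu> (cone A qs) = emeasure ?P (?emb qs)"
      by (simp add: \<mu>_def emeasure_distr vim[OF qs])
    also have "\<dots> = (\<Prod>j\<in>(\<lambda>i. (i, qs ! i)) ` {..<length qs - 1}.
        emeasure (M j) ((\<lambda>(i, q). fx q -` {qs ! Suc i}) j))"
      by (intro emeasure_PiM_emb) (auto simp: M_def)
    also have "\<dots> = (\<Prod>i<length qs - 1. emeasure (measure_pmf (step A (qs ! i))) (fx (qs ! i) -` {qs ! Suc i}))"
      by (subst prod.reindex) (auto simp: inj_on_def M_def)
    also have "\<dots> = (\<Prod>i<length qs - 1. ennreal (pmf (step A (qs ! i)) (qs ! Suc i)))"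
      using qs by (intro prod.cong refl fixp) (auto simp: finite_runs_def)
    also have "\<dots> = cone_prob A qs"
      by (simp add: cone_prob_def prod_ennreal)
    finally show ?thesis .
  qed
  show ?thesis
  proof (rule that)
    show "prob_space \<mu>" unfolding \<mu>_def by (rule prob_space_distr) measurable
    show "space \<mu> = runs A" using sub by (simp add: \<mu>_def N_def)
    show "sets \<mu> = sigma_sets (runs A) (cone A ` finite_runs A)" using sub by (simp add: \<mu>_def N_def)
  qed (rule em)
qed

lemma space_run_measure: "space (run_measure A) = runs A"
  unfolding run_measure_def by (rule space_extend_measure) (auto simp: cone_def)

lemma sets_run_measure: "sets (run_measure A) = sigma_sets (runs A) (cone A ` finite_runs A)"
  unfolding run_measure_def by (rule sets_extend_measure) (auto simp: cone_def)

lemma emeasure_run_measure_cone: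
  assumes "is_pts A" "qs \<in> finite_runs A"
  shows "emeasure (run_measure A) (cone A qs) = cone_prob A qs"
proof -
  obtain \<mu> where \<mu>: "prob_space \<mu>" "space \<mu> = runs A"
    "sets \<mu> = sigma_sets (runs A) (cone A ` finite_runs A)"
    "\<And>qs. qs \<in> finite_runs A \<Longrightarrow> emeasure \<mu> (cone A qs) = cone_prob A qs"
    using ex_run_measure[OF assms(1)] by metis
  have s: "sets (run_measure A) = sets \<mu>" by (simp add: sets_run_measure \<mu>)
  show ?thesis
  proof (rule emeasure_extend_measure[OF run_measure_def[of A], of "emeasure \<mu>"])
    show "positive (sets (run_measure A)) (emeasure \<mu>)" by (simp add: positive_def)
    show "countably_additive (sets (run_measure A)) (emeasure \<mu>)"
      unfolding s by (rule emeasure_countably_additive)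
  qed (use assms \<mu>(4) in \<open>auto simp: cone_def\<close>)
qed

lemma prob_space_run_measure:
  assumes "is_pts A"
  shows "prob_space (run_measure A)"
proof
  have "[start A] \<in> finite_runs A"
    using assms by (auto simp: finite_runs_def is_pts_def)
  moreover have "cone A [start A] = runs A"
    by (auto simp: cone_def runs_def subsequence_def)
  ultimately show "emeasure (run_measure A) (space (run_measure A)) = 1"
    using emeasure_run_measure_cone[OF assms, of "[start A]"]
    by (simp add: space_run_measure cone_prob_def)
qed

end

theory Submission
  imports Defs
begin

text \<open>
  Given a scheduler of the simulated chain, the simulating chain keeps the conditional distribution
  of the simulated run given its own history, and moves by averaging the distributions obtained
  from the simulation over it; intervals being convex, this is a scheduler. Both scheduled chains
  then give every finite word the same probability of being a prefix of the trace. By Koenig's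
  lemma the set of traces is the support of the trace distribution, so both disclose the same words.
  A disclosing set need not be Borel, but the space of runs is compact: approximating
  from inside by traces of closed sets of runs shows that the measurability of its preimage depends
  only on the trace distribution.
\<close>

section \<open>Closed sets of runs\<close>

lemma prefix_eq_iff: "prefix n r = prefix n r' \<longleftrightarrow> (\<forall>i<n. r i = r' i)"
  by (auto simp: subsequence_def)

lemma prefix_eq_mono: "prefix n r = prefix n r' \<Longrightarrow> m \<le> n \<Longrightarrow> prefix m r = prefix m r'"
  by (auto simp: prefix_eq_iff)

lemma prefix_trace: "prefix n (trace A r) = map (label A) (prefix n r)"
  by (simp add: subsequence_def trace_def)

lemma prefix_in_finite_runs: "r \<in> runs A \<Longrightarrow> prefix (Suc n) r \<in> finite_runs A"
  by (auto simp: finite_runs_def runs_def hd_conv_nth simp del: subseq_to_Suc)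

lemma cone_prefix: "cone A (prefix n r) = {r' \<in> runs A. prefix n r' = prefix n r}"
  by (simp add: cone_def)

lemma countable_finite_runs:
  assumes "is_pts A"
  shows "countable (finite_runs A)"
proof (rule countable_subset)
  show "finite_runs A \<subseteq> lists (states A)" by (auto simp: finite_runs_def)
  show "countable (lists (states A))" using assms by (simp add: is_pts_def)
qed

text \<open>Openness in the topology on \<open>runs A\<close> generated by the cones. A set
  \<open>K\<close> of runs is treated as closed when \<open>runs A - K\<close> is open.\<close>

definition open_runs :: "('q, 'a) pts \<Rightarrow> (nat \<Rightarrow> 'q) set \<Rightarrow> bool"
  where "open_runs A U \<longleftrightarrow> U \<subseteq> runs A \<and>
    (\<forall>r\<in>U. \<exists>n. \<forall>r'\<in>runs A. prefix n r' = prefix n r \<longrightarrow> r' \<in> U)"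

lemma open_runs_Int:
  assumes "open_runs A U" "open_runs A V"
  shows "open_runs A (U \<inter> V)"
  unfolding open_runs_def
proof (intro conjI ballI)
  fix r assume "r \<in> U \<inter> V"
  then obtain m n where
    "\<forall>r'\<in>runs A. prefix m r' = prefix m r \<longrightarrow> r' \<in> U"
    "\<forall>r'\<in>runs A. prefix n r' = prefix n r \<longrightarrow> r' \<in> V"
    using assms unfolding open_runs_def by blast
  then have "\<forall>r'\<in>runs A. prefix (max m n) r' = prefix (max m n) r \<longrightarrow> r' \<in> U \<inter> V"
    by (metis IntI max.cobounded1 max.cobounded2 prefix_eq_mono)
  then show "\<exists>n. \<forall>r'\<in>runs A. prefix n r' = prefix n r \<longrightarrow> r' \<in> U \<inter> V" ..
qed (use assms in \<open>auto simp: open_runs_def\<close>)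

lemma open_runs_UN: "(\<And>i. i \<in> I \<Longrightarrow> open_runs A (U i)) \<Longrightarrow> open_runs A (\<Union>i\<in>I. U i)"
  unfolding open_runs_def by fast

lemma open_runs_UNIV: "open_runs A (runs A)"
  by (simp add: open_runs_def)

lemma open_runs_prefix: "open_runs A {r \<in> runs A. P (prefix n r)}"
  unfolding open_runs_def by (auto intro!: exI[of _ n])

text \<open>The factor \<open>runs A\<close> matters at \<open>n = 0\<close>, where the bare
  intersection would be the whole type.\<close>

lemma open_runs_INT_less:
  "(\<And>i. open_runs A (V i)) \<Longrightarrow> open_runs A (runs A \<inter> (\<Inter>i<n::nat. V i))"
proof (induction n)
  case (Suc n)
  then have "open_runs A ((runs A \<inter> (\<Inter>i<n. V i)) \<inter> V n)"
    by (intro open_runs_Int[of A "runs A \<inter> _"]) auto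
  moreover have "(runs A \<inter> (\<Inter>i<n. V i)) \<inter> V n = runs A \<inter> (\<Inter>i<Suc n. V i)"
    by (auto simp: less_Suc_eq)
  ultimately show ?case by metis
qed (simp add: open_runs_UNIV)

text \<open>An open set is the union of the cones it contains, and there are only countably many
  finite runs.\<close>

lemma open_runs_sets:
  assumes "is_pts A" "open_runs A U"
  shows "U \<in> sets (run_measure A)"
proof -
  let ?F = "{qs \<in> finite_runs A. cone A qs \<subseteq> U}"
  have U: "U = (\<Union>qs\<in>?F. cone A qs)"
  proof (intro equalityI subsetI)
    fix r assume r: "r \<in> U"
    then obtain n where n: "\<forall>r'\<in>runs A. prefix n r' = prefix n r \<longrightarrow> r' \<in> U" and "r \<in> runs A"
      using assms(2) unfolding open_runs_def by blast
    \<comment> \<open>\<open>Suc n\<close> rather than \<open>n\<close>: finite runs are nonempty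
      lists.\<close>
    have "cone A (prefix (Suc n) r) \<subseteq> U"
    proof
      fix r' assume "r' \<in> cone A (prefix (Suc n) r)"
      then have r': "r' \<in> runs A" "prefix (Suc n) r' = prefix (Suc n) r"
        unfolding cone_prefix by blast+
      have "prefix n r' = prefix n r" by (rule prefix_eq_mono[OF r'(2)]) simp
      with n r'(1) show "r' \<in> U" by blast
    qed
    moreover have "prefix (Suc n) r \<in> finite_runs A"
      by (rule prefix_in_finite_runs) fact
    moreover have "r \<in> cone A (prefix (Suc n) r)"
      using \<open>r \<in> runs A\<close> by (simp add: cone_prefix del: subseq_to_Suc)
    ultimately show "r \<in> (\<Union>qs\<in>?F. cone A qs)" by blast
  qed auto
  have "countable ?F"
    by (rule countable_subset[OF _ countable_finite_runs[OF assms(1)]]) auto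
  then have "(\<Union>qs\<in>?F. cone A qs) \<in> sets (run_measure A)"
    by (intro sets.countable_UN') (auto simp: sets_run_measure)
  then show ?thesis by (subst U)
qed

text \<open>Koenig's lemma: runs branch finitely, so agreement on all finite prefixes passes to the limit.\<close>

lemma trace_image_closed:
  assumes A: "is_pts A" and K: "K \<subseteq> runs A" and cl: "open_runs A (runs A - K)"
    and w: "\<And>n. \<exists>k\<in>K. prefix n (trace A k) = prefix n w"
  shows "w \<in> trace A ` K"
proof -
  \<comment> \<open>The witness \<open>k\<close> may depend on \<open>n\<close>; the construction
    below replaces these witnesses by a single run.\<close>
  define good where "good qs \<longleftrightarrow>
    (\<forall>n. \<exists>k\<in>K. prefix (length qs) k = qs \<and> prefix n (trace A k) = prefix n w)" for qs
  have ex: "\<exists>q. good (qs @ [q])" if g: "good qs" for qs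
  proof (rule ccontr)
    \<comment> \<open>\<open>C\<close> collects the possible next states after \<open>qs\<close> and
      is finite because supports are. If no extension were good, each \<open>q\<close> would fail at
      some length \<open>N q\<close>; a witness matching \<open>w\<close> up to the maximum of
      \<open>N\<close> over \<open>C\<close> contradicts this.\<close>
    define C where "C = {k (length qs) | k. k \<in> runs A \<and> prefix (length qs) k = qs}"
    have "finite C"
    proof (cases qs rule: rev_cases)
      case Nil
      have "C \<subseteq> {start A}" by (auto simp: C_def runs_def Nil)
      then show ?thesis by (rule finite_subset) simp
    next
      case (snoc qs' q)
      then have "C \<subseteq> (if q \<in> states A then set_pmf (step A q) else {})"
        by (auto simp: C_def runs_def pmf_positive_iff)
      then show ?thesis
        by (rule finite_subset) (use A in \<open>auto simp: is_pts_def\<close>)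
    qed
    assume "\<nexists>q. good (qs @ [q])"
    then have "\<forall>q. \<exists>n. \<forall>k\<in>K. prefix (Suc (length qs)) k = qs @ [q] \<longrightarrow>
        prefix n (trace A k) \<noteq> prefix n w"
      unfolding good_def length_append_singleton by blast
    then obtain N where N: "\<And>q k. k \<in> K \<Longrightarrow> prefix (Suc (length qs)) k = qs @ [q] \<Longrightarrow>
        prefix (N q) (trace A k) \<noteq> prefix (N q) w"
      by metis
    obtain k where k: "k \<in> K" "prefix (length qs) k = qs"
        "prefix (Max (N ` C)) (trace A k) = prefix (Max (N ` C)) w"
      using g unfolding good_def by blast
    have "k (length qs) \<in> C" using k K by (auto simp: C_def)
    then have "N (k (length qs)) \<le> Max (N ` C)" using \<open>finite C\<close> by simp
    then have "prefix (N (k (length qs))) (trace A k) = prefix (N (k (length qs))) w"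
      by (rule prefix_eq_mono[OF k(3)])
    moreover have "prefix (Suc (length qs)) k = qs @ [k (length qs)]"
      using k(2) by simp
    ultimately show False using N[OF k(1)] by blast
  qed
  then obtain next' where next': "\<And>qs. good qs \<Longrightarrow> good (qs @ [next' qs])" by metis
  define h where "h n = ((\<lambda>qs. qs @ [next' qs]) ^^ n) []" for n :: nat
  have "good []" using w by (simp add: good_def)
  then have good_h: "good (h n)" for n by (induction n) (auto simp: h_def next')
  have len_h: "length (h n) = n" for n by (induction n) (auto simp: h_def)
  define r where "r i = next' (h i)" for i
  have pre: "prefix n r = h n" for n
    by (induction n) (simp_all add: h_def r_def)
  \<comment> \<open>Agreement with members of \<open>K\<close> on every finite prefix makes
    \<open>r\<close> a run, puts it into the closed set \<open>K\<close>, and gives it the trace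
    \<open>w\<close>.\<close>
  have approx: "\<exists>k\<in>K. (\<forall>i<n. k i = r i) \<and> (\<forall>i<n. trace A k i = w i)" for n
  proof -
    have "\<exists>k\<in>K. prefix n k = prefix n r \<and> prefix n (trace A k) = prefix n w"
      using good_h[of n] by (simp add: good_def len_h pre)
    then show ?thesis by (simp add: prefix_eq_iff)
  qed
  have "r \<in> runs A"
  proof -
    have "r 0 = start A" using approx[of 1] K by (auto simp: runs_def)
    moreover have "r i \<in> states A \<and> pmf (step A (r i)) (r (Suc i)) > 0" for i
    proof -
      obtain k where k: "k \<in> K" "\<forall>j<Suc (Suc i). k j = r j" using approx by blast
      from k(1) K have "k i \<in> states A \<and> pmf (step A (k i)) (k (Suc i)) > 0"
        unfolding runs_def by blast
      moreover have "k i = r i" "k (Suc i) = r (Suc i)" using k(2) by simp_all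
      ultimately show ?thesis by simp
    qed
    ultimately show ?thesis by (simp add: runs_def)
  qed
  moreover have "\<exists>r'\<in>K. prefix n r' = prefix n r" for n
    using approx[of n] by (auto simp: prefix_eq_iff)
  ultimately have "r \<in> K" using cl K unfolding open_runs_def by blast
  moreover have "trace A r = w"
  proof
    fix i
    obtain k where "k i = r i" "trace A k i = w i" using approx[of "Suc i"] lessI[of i] by metis
    then show "trace A r i = w i" by (simp add: trace_def)
  qed
  ultimately show ?thesis by blast
qed


section \<open>The distribution of traces\<close>

text \<open>For a countable alphabet, this is the Borel sigma-algebra of the product of discrete
  alphabets.\<close>

definition words :: "'a word measure"
  where "words = sigma UNIV (range (\<lambda>u. {w. prefix (length u) w = u}))"

lemma space_words [simp]: "space words = UNIV"
  by (simp add: words_def)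

lemma cylinder_sets [measurable]: "{w. prefix (length u) w = u} \<in> sets words"
  by (auto simp: words_def)

text \<open>A closed language is the intersection over \<open>n\<close> of the cylinders around its
  prefixes of length \<open>n\<close>; for each \<open>n\<close> these are countably many.\<close>

lemma closed_words_sets:
  fixes L :: "'a::countable word set"
  assumes "\<And>w. (\<And>n. \<exists>v\<in>L. prefix n v = prefix n w) \<Longrightarrow> w \<in> L"
  shows "L \<in> sets words"
proof -
  have "L = (\<Inter>n. \<Union>u\<in>prefix n ` L. {w. prefix (length u) w = u})"
  proof (rule set_eqI)
    fix w
    have "w \<in> L \<longleftrightarrow> (\<forall>n. \<exists>v\<in>L. prefix n w = prefix n v)"
      by (metis assms)
    then show "w \<in> L \<longleftrightarrow> w \<in> (\<Inter>n. \<Union>u\<in>prefix n ` L. {w. prefix (length u) w = u})"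
      by simp
  qed
  also have "\<dots> \<in> sets words"
    by (intro sets.countable_INT'' sets.countable_UN' image_subsetI cylinder_sets countableI_type) (simp_all flip: space_words)
  finally show ?thesis .
qed

lemma trace_measurable [measurable]:
  assumes "is_pts A"
  shows "trace A \<in> measurable (run_measure A) words"
  unfolding words_def
proof (rule measurable_measure_of)
  fix L :: "'b word set"
  assume "L \<in> range (\<lambda>u. {w. prefix (length u) w = u})"
  then obtain u where L: "L = {w. prefix (length u) w = u}" by blast
  have "trace A -` L \<inter> space (run_measure A) =
      {r \<in> runs A. map (label A) (prefix (length u) r) = u}"
    by (auto simp: L space_run_measure prefix_trace)
  then show "trace A -` L \<inter> space (run_measure A) \<in> sets (run_measure A)"
    using open_runs_sets[OF assms open_runs_prefix[of A "\<lambda>v. map (label A) v = u"]] by simp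
qed auto

section \<open>Approximation of measurable sets of runs and their traces\<close>

text \<open>
  Together, \<^term>\<open>runs A - V\<close> and \<^term>\<open>U\<close> approximate \<^term>\<open>X\<close> from inside and outside; the
  statement is symmetric under complementation because it speaks about the open sets only.
\<close>

lemma run_measure_regular:
  assumes A: "is_pts A" and X: "X \<in> sets (run_measure A)" and "e > 0"
  shows "\<exists>V U. open_runs A V \<and> open_runs A U \<and> runs A - V \<subseteq> X \<and> X \<subseteq> U \<and>
    measure (run_measure A) (U \<inter> V) < e"
proof -
  interpret prob_space "run_measure A" by (rule prob_space_run_measure[OF A])
  note os = open_runs_sets[OF A]
  have "X \<in> sigma_sets (runs A) (cone A ` finite_runs A)"
    using X by (simp add: sets_run_measure)
  from this \<open>e > 0\<close> show ?thesis
  proof (induction arbitrary: e)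
    case (Basic X)
    then obtain qs where X: "X = {r \<in> runs A. prefix (length qs) r = qs}"
      by (auto simp: cone_def)
    \<comment> \<open>Cones are both open and closed, so the approximation is exact.\<close>
    have "runs A - X = {r \<in> runs A. prefix (length qs) r \<noteq> qs}"
      by (auto simp: X)
    then have "open_runs A X" "open_runs A (runs A - X)"
      unfolding X using open_runs_prefix[of A _ "length qs"] by auto
    moreover have "X \<inter> (runs A - X) = {}" by auto
    ultimately show ?case
      using Basic.prems X by (intro exI[of _ "runs A - X"] exI[of _ X]) auto
  next
    case Empty
    have "open_runs A {}" by (simp add: open_runs_def)
    then show ?case
      using open_runs_UNIV[of A] Empty by (intro exI[of _ "runs A"] exI[of _ "{}"]) auto
  next
    case (Compl X)
    from Compl.IH[OF Compl.prems] obtain V U where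
      "open_runs A V" "open_runs A U" "runs A - V \<subseteq> X" "X \<subseteq> U"
      "measure (run_measure A) (U \<inter> V) < e" by blast
    then show ?case
      by (intro exI[of _ U] exI[of _ V]) (auto simp: Int_commute open_runs_def)
  next
    case (Union X)
    \<comment> \<open>These errors add up to \<open>e / 2\<close>, strictly below \<open>e\<close>,
      which leaves room for the limit in \<open>n\<close>.\<close>
    have pos: "e / 2 * (1 / 2) ^ Suc i > 0" for i using Union.prems by simp
    have "\<exists>V U. open_runs A V \<and> open_runs A U \<and> runs A - V \<subseteq> X i \<and> X i \<subseteq> U \<and>
        measure (run_measure A) (U \<inter> V) < e / 2 * (1 / 2) ^ Suc i" for i
      by (rule Union.IH[OF pos])
    then obtain V U where VU: "\<And>i. open_runs A (V i)" "\<And>i. open_runs A (U i)"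
      "\<And>i. runs A - V i \<subseteq> X i" "\<And>i. X i \<subseteq> U i"
      "\<And>i. measure (run_measure A) (U i \<inter> V i) < e / 2 * (1 / 2) ^ Suc i" by metis
    \<comment> \<open>Infinitely many closed sets need not have a closed union, so only the first
      \<open>n\<close> inner approximations are united; \<open>W n\<close> is the remaining gap. The
      gaps decrease to a subset of \<open>\<Union>i. U i \<inter> V i\<close>, so one of them has
      measure below \<open>e\<close>.\<close>
    define W where "W n = (\<Union>i. U i) \<inter> (runs A \<inter> (\<Inter>i<n. V i))" for n
    have oU: "open_runs A (\<Union>i. U i)" using VU(2) by (intro open_runs_UN)
    have W: "W n \<in> sets (run_measure A)" for n
      unfolding W_def by (intro os open_runs_Int open_runs_INT_less VU oU)
    have geo: "(\<lambda>i. e / 2 * (1 / 2) ^ Suc i) sums (e / 2)"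
      using sums_mult[OF power_half_series, of "e / 2"] by simp
    have UV: "U i \<inter> V i \<in> sets (run_measure A)" for i
      by (intro os open_runs_Int VU)
    have summ: "summable (\<lambda>i. measure (run_measure A) (U i \<inter> V i))"
      by (rule summable_comparison_test'[OF sums_summable[OF geo], of 0])
        (use VU(5) in \<open>auto intro!: less_imp_le simp del: power_Suc\<close>)
    have "measure (run_measure A) (\<Inter>n. W n) \<le> measure (run_measure A) (\<Union>i. U i \<inter> V i)"
      using UV by (intro finite_measure_mono) (auto simp: W_def)
    also have "\<dots> \<le> (\<Sum>i. measure (run_measure A) (U i \<inter> V i))"
      using UV summ by (intro finite_measure_subadditive_countably) auto
    also have "\<dots> \<le> (\<Sum>i. e / 2 * (1 / 2) ^ Suc i)"
      using VU(5) by (intro suminf_le summ sums_summable[OF geo] less_imp_le)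
    also have "\<dots> < e"
      using sums_unique[OF geo] Union.prems by linarith
    finally have "measure (run_measure A) (\<Inter>n. W n) < e" .
    moreover have "(\<lambda>n. measure (run_measure A) (W n)) \<longlonglongrightarrow> measure (run_measure A) (\<Inter>n. W n)"
      using W by (intro finite_Lim_measure_decseq)
        (fastforce simp: W_def decseq_def)+
    ultimately have "\<forall>\<^sub>F n in sequentially. measure (run_measure A) (W n) < e"
      by (rule order_tendstoD(2)[rotated])
    then obtain n where "measure (run_measure A) (W n) < e"
      by (auto simp: eventually_sequentially)
    moreover have "runs A - (runs A \<inter> (\<Inter>i<n. V i)) \<subseteq> (\<Union>i. X i)"
      using VU(3) by blast
    moreover have "(\<Union>i. X i) \<subseteq> (\<Union>i. U i)"
      using VU(4) by blast
    ultimately show ?case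
      unfolding W_def using oU open_runs_INT_less[of A V n] VU(1) by meson
  qed
qed

text \<open>By regularity, countably many closed sets inside \<open>S\<close> exhaust its measure.
  Their traces are closed languages by \<open>trace_image_closed\<close>, so the union
  \<open>G\<close> of these is measurable, and its preimage contains all the closed sets
  chosen.\<close>

lemma trace_image_inner:
  fixes A :: "('q, 'a::countable) pts"
  assumes A: "is_pts A" and S: "S \<in> sets (run_measure A)"
  shows "\<exists>G\<in>sets words. G \<subseteq> trace A ` S \<and>
    measure (run_measure A) S \<le> measure (distr (run_measure A) words (trace A)) G"
proof -
  interpret prob_space "run_measure A" by (rule prob_space_run_measure[OF A])
  let ?m = "measure (run_measure A)"
  note os = open_runs_sets[OF A]
  have "\<forall>n::nat. \<exists>V U. open_runs A V \<and> open_runs A U \<and> runs A - V \<subseteq> S \<and> S \<subseteq> U \<and>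
    ?m (U \<inter> V) < 1 / Suc n"
    by (intro allI run_measure_regular A S) simp
  then obtain V U where VU: "\<And>n. open_runs A (V n)" "\<And>n. open_runs A (U n)"
    "\<And>n. runs A - V n \<subseteq> S" "\<And>n. S \<subseteq> U n" "\<And>n::nat. ?m (U n \<inter> V n) < 1 / Suc n"
    by metis
  define G where "G = (\<Union>n. trace A ` (runs A - V n))"
  have dbl: "runs A - (runs A - V n) = V n" for n
    using VU(1)[of n] by (auto simp: open_runs_def)
  have G: "G \<in> sets words"
    unfolding G_def
  proof (intro sets.countable_UN'' closed_words_sets)
    fix n w assume *: "\<And>m. \<exists>v\<in>trace A ` (runs A - V n). prefix m v = prefix m w"
    show "w \<in> trace A ` (runs A - V n)"
      by (rule trace_image_closed[OF A]) (use * VU(1) in \<open>auto simp: dbl\<close>)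
  qed auto
  have vG: "trace A -` G \<inter> runs A \<in> sets (run_measure A)"
    using measurable_sets[OF trace_measurable[OF A] G] by (simp add: space_run_measure)
  have "?m S \<le> ?m (trace A -` G \<inter> runs A) + 1 / Suc n" for n
  proof -
    have "?m S \<le> ?m ((trace A -` G \<inter> runs A) \<union> (U n \<inter> V n))"
    proof (rule finite_measure_mono)
      \<comment> \<open>A run of \<open>S\<close> outside \<open>V n\<close> has its trace in
        \<open>G\<close>; one inside \<open>V n\<close> lies in the gap.\<close>
      show "S \<subseteq> (trace A -` G \<inter> runs A) \<union> (U n \<inter> V n)"
        using VU(2,4)[of n] unfolding G_def open_runs_def by blast
    qed (intro sets.Un vG os open_runs_Int VU)
    also have "\<dots> \<le> ?m (trace A -` G \<inter> runs A) + ?m (U n \<inter> V n)"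
      by (intro measure_Un_le vG os open_runs_Int VU)
    finally show ?thesis using VU(5)[of n] by linarith
  qed
  moreover have "(\<lambda>n. ?m (trace A -` G \<inter> runs A) + 1 / Suc n) \<longlonglongrightarrow> ?m (trace A -` G \<inter> runs A) + 0"
    by (intro tendsto_intros LIMSEQ_Suc[OF lim_inverse_n'])
  ultimately have "?m S \<le> ?m (trace A -` G \<inter> runs A)"
    by (intro LIMSEQ_le_const) auto
  also have "\<dots> = measure (distr (run_measure A) words (trace A)) G"
    using G A by (simp add: measure_distr trace_measurable space_run_measure)
  finally have "?m S \<le> measure (distr (run_measure A) words (trace A)) G" .
  then show ?thesis using G VU(3) by (intro bexI[of _ G]) (auto simp: G_def)
qed

section \<open>What the cylinder probabilities determine\<close>

lemma emeasure_trace_cylinder: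
  assumes "is_pts A"
  shows "emeasure (distr (run_measure A) words (trace A)) {w. prefix (length u) w = u} =
    emeasure (run_measure A) {r \<in> runs A. prefix (length u) (trace A r) = u}"
proof -
  have "trace A -` {w. prefix (length u) w = u} \<inter> space (run_measure A) =
      {r \<in> runs A. prefix (length u) (trace A r) = u}"
    by (auto simp: space_run_measure)
  then show ?thesis
    by (simp only: emeasure_distr[OF trace_measurable[OF assms] cylinder_sets])
qed

text \<open>Two cylinders are nested or disjoint, so together with the empty set they form a
  generator stable under intersection.\<close>

lemma trace_distr_eqI:
  assumes A: "is_pts A" and B: "is_pts B"
    and eq: "\<And>u. emeasure (run_measure A) {r \<in> runs A. prefix (length u) (trace A r) = u} =
      emeasure (run_measure B) {r \<in> runs B. prefix (length u) (trace B r) = u}"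
  shows "distr (run_measure A) words (trace A) = distr (run_measure B) words (trace B)"
proof (rule measure_eqI_generator_eq[where \<Omega> = UNIV and A = "\<lambda>_. UNIV"
      and E = "insert {} (range (\<lambda>u. {w. prefix (length u) w = u}))"])
  interpret prob_space "run_measure A" by (rule prob_space_run_measure[OF A])
  interpret D: prob_space "distr (run_measure A) words (trace A)"
    by (rule prob_space_distr[OF trace_measurable[OF A]])
  let ?C = "\<lambda>u::'b list. {w. prefix (length u) w = u}"
  have C: "?C u \<inter> ?C v \<in> {{}, ?C u}" if "length v \<le> length u" for u v
  proof -
    have "prefix (length v) w = take (length v) u" if "prefix (length u) w = u" for w
      using \<open>length v \<le> length u\<close> by (subst that[symmetric]) (simp add: subsequence_def take_map)
    then show ?thesis by auto
  qed
  have "?C u \<inter> ?C v \<in> insert {} (range ?C)" for u v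
    using C[of u v] C[of v u] by (cases "length u \<le> length v") auto
  then show "Int_stable (insert {} (range ?C))"
    by (auto simp: Int_stable_def)
  show "emeasure (distr (run_measure A) words (trace A)) X =
      emeasure (distr (run_measure B) words (trace B)) X" if "X \<in> insert {} (range ?C)" for X
    using that A B eq by (auto simp: emeasure_trace_cylinder)
  have "sets words = sigma_sets UNIV (insert {} (range ?C))"
    by (auto simp: words_def intro!: sigma_sets_eqI intro: sigma_sets.Empty)
  then show "sets (distr (run_measure A) words (trace A)) = sigma_sets UNIV (insert {} (range ?C))"
    "sets (distr (run_measure B) words (trace B)) = sigma_sets UNIV (insert {} (range ?C))"
    by simp_all
  show "range (\<lambda>_. UNIV) \<subseteq> insert {} (range ?C)"
    by (auto intro!: image_eqI[of _ _ "[]"])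
  show "emeasure (distr (run_measure A) words (trace A)) UNIV \<noteq> \<infinity>"
    using D.emeasure_space_1 by simp
qed auto

text \<open>Edges of a run have positive probability, hence so do the cones around it. Conversely,
  events of positive probability are nonempty, and \<open>trace_image_closed\<close> merges the runs
  found for each \<open>n\<close> into one. Thus cylinder probabilities determine
  \<open>Tr A\<close>.\<close>

lemma Tr_iff_support:
  assumes A: "is_pts A"
  shows "w \<in> Tr A \<longleftrightarrow>
    (\<forall>n. emeasure (run_measure A) {r \<in> runs A. prefix n (trace A r) = prefix n w} > 0)"
proof
  assume "w \<in> Tr A"
  then obtain r where r: "r \<in> runs A" "w = trace A r" by (auto simp: Tr_def)
  show "\<forall>n. emeasure (run_measure A) {r \<in> runs A. prefix n (trace A r) = prefix n w} > 0"
  proof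
    fix n
    let ?qs = "prefix (Suc n) r"
    have "?qs ! i = r i" if "i \<le> n" for i
      using that by (simp del: subseq_to_Suc)
    then have "0 < cone_prob A ?qs"
      using r(1) unfolding cone_prob_def by (intro prod_pos) (auto simp: runs_def simp del: subseq_to_Suc)
    then have "0 < ennreal (cone_prob A ?qs)" by simp
    also have "\<dots> = emeasure (run_measure A) (cone A ?qs)"
      by (rule emeasure_run_measure_cone[OF A prefix_in_finite_runs[OF r(1)], symmetric])
    also have "\<dots> \<le> emeasure (run_measure A) {r' \<in> runs A. prefix n (trace A r') = prefix n w}"
    proof (rule emeasure_mono)
      show "cone A ?qs \<subseteq> {r' \<in> runs A. prefix n (trace A r') = prefix n w}"
        unfolding cone_prefix r(2) prefix_trace by auto
      show "{r' \<in> runs A. prefix n (trace A r') = prefix n w} \<in> sets (run_measure A)"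
        unfolding prefix_trace by (intro open_runs_sets A open_runs_prefix)
    qed
    finally show "emeasure (run_measure A) {r \<in> runs A. prefix n (trace A r) = prefix n w} > 0" .
  qed
next
  assume pos: "\<forall>n. emeasure (run_measure A) {r \<in> runs A. prefix n (trace A r) = prefix n w} > 0"
  have "\<exists>k\<in>runs A. prefix n (trace A k) = prefix n w" for n
  proof (rule ccontr)
    assume "\<not> ?thesis"
    then have *: "{r \<in> runs A. prefix n (trace A r) = prefix n w} = {}" by auto
    show False using pos[rule_format, of n] unfolding * by simp
  qed
  then show "w \<in> Tr A"
    unfolding Tr_def by (intro trace_image_closed A) (auto simp: open_runs_def)
qed

text \<open>
  If the preimage of \<^term>\<open>W\<close> under the trace map of \<^term>\<open>A\<close> is measurable, then \<^term>\<open>W\<close> lies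
  between two measurable sets of words of the same probability: traces of closed sets of runs
  approximate \<^term>\<open>W\<close> and its complement. Hence measurability carries over to \<^term>\<open>B\<close>.
\<close>

lemma word_prob_le:
  fixes A :: "('q, 'a::countable) pts" and B :: "('p, 'a) pts"
  assumes A: "is_pts A" and B: "is_pts B"
    and eq: "distr (run_measure A) words (trace A) = distr (run_measure B) words (trace B)"
  shows "word_prob A W \<le> word_prob B W"
proof (cases "{r \<in> runs A. trace A r \<in> W} \<in> sets (completion (run_measure A))")
  case False
  \<comment> \<open>Outside the completed sigma-algebra \<open>emeasure\<close> is \<open>0\<close>,
    which makes the inequality trivial.\<close>
  then show ?thesis by (simp add: word_prob_def emeasure_notin_sets)
next
  case True
  interpret PA: prob_space "run_measure A" by (rule prob_space_run_measure[OF A])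
  interpret PB: prob_space "run_measure B" by (rule prob_space_run_measure[OF B])
  let ?D = "distr (run_measure A) words (trace A)"
  interpret D: prob_space ?D by (rule PA.prob_space_distr[OF trace_measurable[OF A]])
  let ?X = "{r \<in> runs A. trace A r \<in> W}"
  let ?Y = "{r \<in> runs B. trace B r \<in> W}"
  from True obtain S N N' where X: "?X = S \<union> N" "N \<subseteq> N'" "N' \<in> null_sets (run_measure A)"
    "S \<in> sets (run_measure A)" by (rule sets_completionE)
  \<comment> \<open>\<open>S\<close> and this set fill the preimage of \<open>W\<close> and its
    complement up to parts of the null set \<open>N'\<close>.\<close>
  have T: "runs A - (S \<union> N') \<in> sets (run_measure A)"
    using X by (intro sets.Diff sets.Un) (auto simp flip: space_run_measure)
  obtain G where G: "G \<in> sets words" "G \<subseteq> trace A ` S"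
    "measure (run_measure A) S \<le> measure ?D G"
    using trace_image_inner[OF A X(4)] by blast
  obtain H where H: "H \<in> sets words" "H \<subseteq> trace A ` (runs A - (S \<union> N'))"
    "measure (run_measure A) (runs A - (S \<union> N')) \<le> measure ?D H"
    using trace_image_inner[OF A T] by blast
  have GW: "G \<subseteq> W" using G(2) X by auto
  have HW: "W \<subseteq> - H" using H(2) X by fastforce
  have SN: "measure (run_measure A) (S \<union> N') = measure (run_measure A) S"
    using X by (simp add: measure_Un_null_set)
  \<comment> \<open>The sandwich \<open>G \<subseteq> W \<subseteq> - H\<close> is tight:
    \<open>G\<close> and \<open>H\<close> together have at least the mass of \<open>S\<close> and of
    the complement of \<open>S \<union> N'\<close>, which is \<open>1\<close>.\<close>
  have "measure ?D (- H) = 1 - measure ?D H"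
    using D.prob_compl[of H] H(1) by (simp add: Compl_eq_Diff_UNIV)
  also have "\<dots> \<le> 1 - measure (run_measure A) (runs A - (S \<union> N'))" using H(3) by simp
  also have "\<dots> = measure (run_measure A) (S \<union> N')"
    using PA.prob_compl[of "S \<union> N'"] X(4) null_setsD2[OF X(3)] by (simp add: space_run_measure sets.Un)
  also have "\<dots> \<le> measure ?D G" using G(3) SN by simp
  finally have "measure ?D (- H) \<le> measure ?D G" .
  moreover have "- H \<in> sets words" using H(1) sets.compl_sets[of H words] by (simp add: Compl_eq_Diff_UNIV)
  moreover have "measure ?D G \<le> measure ?D (- H)"
    using GW HW calculation(2) by (intro D.finite_measure_mono) auto
  ultimately have GH: "emeasure ?D G = emeasure ?D (- H)" "- H \<in> sets words"
    by (auto simp: D.emeasure_eq_measure)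
  have vB: "trace B -` L \<inter> runs B \<in> sets (run_measure B)"
    "emeasure (run_measure B) (trace B -` L \<inter> runs B) = emeasure ?D L" if "L \<in> sets words" for L
    using that measurable_sets[OF trace_measurable[OF B] that] B unfolding eq
    by (auto simp: emeasure_distr trace_measurable space_run_measure)
  let ?E = "emeasure (completion (run_measure B))"
  \<comment> \<open>Since the trace distributions agree, the same sandwich works for
    \<open>B\<close>.\<close>
  have Y: "?Y \<in> sets (completion (run_measure B))"
  proof (rule completion.complete_sets_sandwich)
    show "trace B -` G \<inter> runs B \<subseteq> ?Y" "?Y \<subseteq> trace B -` (- H) \<inter> runs B"
      using GW HW by auto
  qed (use vB[OF G(1)] vB[OF GH(2)] GH in \<open>auto simp: D.emeasure_eq_measure\<close>)
  have "word_prob A W = emeasure (run_measure A) S"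
  proof -
    let ?EA = "emeasure (completion (run_measure A))"
    have SN': "S \<union> N' \<in> sets (run_measure A)"
      using X(4) null_setsD2[OF X(3)] by (rule sets.Un)
    have "?EA S \<le> ?EA ?X"
      using True X(1) by (intro emeasure_mono) auto
    moreover have "?EA ?X \<le> ?EA (S \<union> N')"
      using X(1,2) SN' by (intro emeasure_mono) auto
    moreover have "?EA (S \<union> N') = ?EA S"
      using X(3,4) SN' by (simp add: emeasure_Un_null_set)
    ultimately have "?EA ?X = ?EA S" by (metis order_antisym)
    then show ?thesis
      using X(4) unfolding word_prob_def by simp
  qed
  also have "\<dots> \<le> emeasure ?D G"
    using G(3) by (simp add: PA.emeasure_eq_measure D.emeasure_eq_measure)
  also have "\<dots> = ?E (trace B -` G \<inter> runs B)"
    using vB[OF G(1)] by simp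
  also have "\<dots> \<le> ?E ?Y"
    using Y GW by (intro emeasure_mono) auto
  finally show ?thesis by (simp add: word_prob_def)
qed

text \<open>Equal cylinder probabilities give equal sets of traces, hence the same disclosing words;
  these are then compared under one common trace distribution.\<close>

lemma Disc_le:
  fixes A :: "('q, 'a::countable) pts" and B :: "('p, 'a) pts"
  assumes A: "is_pts A" and B: "is_pts B"
    and eq: "\<And>u. emeasure (run_measure A) {r \<in> runs A. prefix (length u) (trace A r) = u} =
      emeasure (run_measure B) {r \<in> runs B. prefix (length u) (trace B r) = u}"
  shows "Disc A O' \<phi> \<le> Disc B O' \<phi>"
proof -
  have *: "emeasure (run_measure A) {r \<in> runs A. prefix n (trace A r) = prefix n w} =
      emeasure (run_measure B) {r \<in> runs B. prefix n (trace B r) = prefix n w}" for n w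
    using eq[of "prefix n w"] unfolding subsequence_length diff_zero .
  have "w \<in> Tr A \<longleftrightarrow> w \<in> Tr B" for w
    by (simp only: Tr_iff_support[OF A] Tr_iff_support[OF B] *)
  then have "Tr A = Tr B" by blast
  then have "disclosing A O' \<phi> = disclosing B O' \<phi>"
    by (simp add: disclosing_def)
  then show ?thesis
    unfolding Disc_def using word_prob_le[OF A B trace_distr_eqI[OF A B eq]] by simp
qed


section \<open>Traces of scheduled chains\<close>

text \<open>The law of the state of \<open>schedule S A\<close> after \<open>n\<close> steps; that
  state is itself a finite run.\<close>

primrec run_pmf :: "('s::finite, 'a) idtmc \<Rightarrow> ('s frun \<Rightarrow> 's pmf) \<Rightarrow> nat \<Rightarrow> 's frun pmf" where
  "run_pmf S A 0 = return_pmf (Init (init S))"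
| "run_pmf S A (Suc n) = run_pmf S A n \<bind> (\<lambda>\<rho>. map_pmf (Ext \<rho> (A \<rho>)) (A \<rho>))"

text \<open>The path from the root to a given node in the tree of finite runs.\<close>

primrec history :: "'s frun \<Rightarrow> 's frun list" where
  "history (Init s) = [Init s]"
| "history (Ext \<rho> \<mu> s) = history \<rho> @ [Ext \<rho> \<mu> s]"

definition frun_trace :: "('s, 'a) idtmc \<Rightarrow> 's frun \<Rightarrow> 'a list"
  where "frun_trace S \<rho> = map (lab S \<circ> lst) (history \<rho>)"

lemma history_neq_Nil [simp]: "history \<rho> \<noteq> []"
  by (cases \<rho>) auto

lemma last_history [simp]: "last (history \<rho>) = \<rho>"
  by (cases \<rho>) auto

lemma frun_trace_simps [simp]:
  "frun_trace S (Init s) = [lab S s]"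
  "frun_trace S (Ext \<rho> \<mu> s) = frun_trace S \<rho> @ [lab S s]"
  by (simp_all add: frun_trace_def)

lemma schedule_simps [simp]:
  "states (schedule S A) = generated S A"
  "start (schedule S A) = Init (init S)"
  "step (schedule S A) \<rho> = map_pmf (Ext \<rho> (A \<rho>)) (A \<rho>)"
  "label (schedule S A) = lab S \<circ> lst"
  by (simp_all add: schedule_def)

lemma finite_run_pmf: "finite (set_pmf (run_pmf S A n))"
  by (induction n) auto

lemma pmf_Ext: "pmf (map_pmf (Ext \<rho> (A \<rho>)) (A \<rho>)) (Ext \<rho> (A \<rho>) s) = pmf (A \<rho>) s"
  by (simp add: pmf_map_inj' inj_def)

text \<open>An extended run records its predecessor, so only one summand of the bind
  survives.\<close>

lemma pmf_run_pmf_Suc: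
  "pmf (run_pmf S A (Suc n)) (Ext \<rho> (A \<rho>) s) = pmf (run_pmf S A n) \<rho> * pmf (A \<rho>) s"
proof -
  have "pmf (map_pmf (Ext \<rho>' (A \<rho>')) (A \<rho>')) (Ext \<rho> (A \<rho>) s) = indicator {\<rho>} \<rho>' * pmf (A \<rho>) s" for \<rho>'
  proof (cases "\<rho>' = \<rho>")
    case False
    then have "Ext \<rho> (A \<rho>) s \<notin> set_pmf (map_pmf (Ext \<rho>' (A \<rho>')) (A \<rho>'))" by auto
    then have "pmf (map_pmf (Ext \<rho>' (A \<rho>')) (A \<rho>')) (Ext \<rho> (A \<rho>) s) = 0"
      by (simp only: set_pmf_iff not_not)
    with False show ?thesis by simp
  qed (simp add: pmf_Ext)
  then show ?thesis
    by (simp add: pmf_bind measure_pmf_single)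
qed

text \<open>The scheduled system is a tree: a node at depth \<open>n\<close> is reached along its
  history only, so its probability is that of a single cone.\<close>

lemma run_pmf_history:
  "\<rho> \<in> set_pmf (run_pmf S A n) \<Longrightarrow>
    \<rho> \<in> generated S A \<and> length (history \<rho>) = Suc n \<and>
    history \<rho> \<in> finite_runs (schedule S A) \<and>
    cone_prob (schedule S A) (history \<rho>) = pmf (run_pmf S A n) \<rho>"
proof (induction n arbitrary: \<rho>)
  case 0
  then show ?case by (auto simp: finite_runs_def cone_prob_def intro: generated.intros)
next
  case (Suc n)
  then obtain \<rho>' s where \<rho>: "\<rho> = Ext \<rho>' (A \<rho>') s" "\<rho>' \<in> set_pmf (run_pmf S A n)" "s \<in> set_pmf (A \<rho>')"
    by auto
  note IH = Suc.IH[OF \<rho>(2)]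
  let ?h = "history \<rho>'"
  have last: "?h ! n = \<rho>'"
    using IH last_conv_nth[of ?h] by simp
  have step: "pmf (step (schedule S A) (?h ! n)) \<rho> = pmf (A \<rho>') s"
    unfolding last \<rho>(1) by (simp add: pmf_Ext)
  have gen: "\<rho> \<in> generated S A"
    using IH \<rho>(1) by (auto intro: generated.intros)
  have "history \<rho> \<in> finite_runs (schedule S A)"
    unfolding finite_runs_def
  proof (intro CollectI conjI allI impI)
    fix i assume i: "Suc i < length (history \<rho>)"
    show "0 < pmf (step (schedule S A) (history \<rho> ! i)) (history \<rho> ! Suc i)"
    proof (cases "i = n")
      case True
      have "0 < pmf (A \<rho>') s" using \<rho>(3) by (simp add: pmf_positive)
      then show ?thesis using IH step True unfolding \<rho>(1) by (simp add: nth_append)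
    next
      case False
      then have "Suc i < length ?h" using i IH by (simp add: \<rho>(1))
      moreover from this have "0 < pmf (step (schedule S A) (?h ! i)) (?h ! Suc i)"
        using IH unfolding finite_runs_def by blast
      ultimately show ?thesis unfolding \<rho>(1) by (simp add: nth_append)
    qed
  qed (use IH gen \<rho>(1) in \<open>auto simp: finite_runs_def\<close>)
  moreover have "cone_prob (schedule S A) (history \<rho>) = pmf (run_pmf S A (Suc n)) \<rho>"
  proof -
    have "cone_prob (schedule S A) (history \<rho>) =
        (\<Prod>i<n. pmf (step (schedule S A) (history \<rho> ! i)) (history \<rho> ! Suc i)) *
        pmf (step (schedule S A) (history \<rho> ! n)) (history \<rho> ! Suc n)"
      using IH by (simp add: cone_prob_def \<rho>(1))
    also have "(\<Prod>i<n. pmf (step (schedule S A) (history \<rho> ! i)) (history \<rho> ! Suc i)) =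
        cone_prob (schedule S A) ?h"
      unfolding cone_prob_def using IH
      by (intro prod.cong) (auto simp: \<rho>(1) nth_append simp del: schedule_simps)
    also have "pmf (step (schedule S A) (history \<rho> ! n)) (history \<rho> ! Suc n) = pmf (A \<rho>') s"
      using IH step unfolding \<rho>(1) by (simp add: nth_append)
    finally show ?thesis
      using IH unfolding \<rho>(1) pmf_run_pmf_Suc by simp
  qed
  ultimately show ?case using IH gen by (simp add: \<rho>(1))
qed

text \<open>A state stores its whole past, so the state at time \<open>n\<close> fixes all earlier
  ones.\<close>

lemma prefix_run_schedule:
  "r \<in> runs (schedule S A) \<Longrightarrow> r n \<in> set_pmf (run_pmf S A n) \<and> prefix (Suc n) r = history (r n)"
proof (induction n)
  case 0
  then show ?case by (simp add: runs_def)
next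
  case (Suc n)
  then have "0 < pmf (step (schedule S A) (r n)) (r (Suc n))" by (simp add: runs_def)
  then have "r (Suc n) \<in> set_pmf (map_pmf (Ext (r n) (A (r n))) (A (r n)))"
    by (simp only: pmf_positive_iff schedule_simps)
  then obtain s where s: "r (Suc n) = Ext (r n) (A (r n)) s" "s \<in> set_pmf (A (r n))" by auto
  have "prefix (Suc (Suc n)) r = prefix (Suc n) r @ [r (Suc n)]" by simp
  also have "\<dots> = history (r (Suc n))"
    using Suc unfolding s(1) by (simp del: subseq_to_Suc)
  finally show ?case using Suc s by auto
qed

text \<open>The event splits into finitely many disjoint cones, one for each node at depth
  \<open>n\<close> with trace \<open>u\<close>. After \<open>n\<close> steps, \<open>Suc n\<close>
  letters have been read.\<close>

lemma emeasure_trace_schedule: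
  "emeasure (run_measure (schedule S A))
      {r \<in> runs (schedule S A). prefix (Suc n) (trace (schedule S A) r) = u} =
    pmf (map_pmf (frun_trace S) (run_pmf S A n)) u"
proof -
  let ?P = "schedule S A"
  let ?M = "run_measure ?P"
  let ?R = "{\<rho> \<in> set_pmf (run_pmf S A n). frun_trace S \<rho> = u}"
  have finR: "finite ?R" using finite_run_pmf by (rule rev_finite_subset) auto
  note pre = prefix_run_schedule[of _ S A n]
  have cone: "cone ?P (history \<rho>) = {r \<in> runs ?P. r n = \<rho>}" if "\<rho> \<in> set_pmf (run_pmf S A n)" for \<rho>
  proof -
    have "length (history \<rho>) = Suc n" using run_pmf_history[OF that] by blast
    moreover have "history (r n) = history \<rho> \<longleftrightarrow> r n = \<rho>" for r :: "nat \<Rightarrow> 'a frun"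
      by (metis last_history)
    ultimately show ?thesis using pre by (auto simp: cone_def simp del: subseq_to_Suc)
  qed
  have tr: "prefix (Suc n) (trace ?P r) = frun_trace S (r n)" if "r \<in> runs ?P" for r
    unfolding prefix_trace using pre[OF that] by (simp add: frun_trace_def del: subseq_to_Suc)
  have meas: "cone ?P (history \<rho>) \<in> sets ?M" if "\<rho> \<in> set_pmf (run_pmf S A n)" for \<rho>
    using run_pmf_history[OF that] by (auto simp: sets_run_measure)
  have "{r \<in> runs ?P. prefix (Suc n) (trace ?P r) = u} = (\<Union>\<rho>\<in>?R. cone ?P (history \<rho>))"
    using pre by (auto simp: cone tr simp del: subseq_to_Suc)
  also have "emeasure ?M \<dots> = (\<Sum>\<rho>\<in>?R. emeasure ?M (cone ?P (history \<rho>)))"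
  proof (rule sum_emeasure[symmetric])
    show "disjoint_family_on (\<lambda>\<rho>. cone ?P (history \<rho>)) ?R"
      by (auto simp: disjoint_family_on_def cone)
  qed (use meas finR in auto)
  also have "\<dots> = (\<Sum>\<rho>\<in>?R. ennreal (pmf (run_pmf S A n) \<rho>))"
    by (intro sum.cong) (auto simp: emeasure_run_measure_cone[OF is_pts_schedule] dest!: run_pmf_history)
  also have "\<dots> = ennreal (\<Sum>\<rho>\<in>?R. pmf (run_pmf S A n) \<rho>)"
    by (intro sum_ennreal) simp
  also have "(\<Sum>\<rho>\<in>?R. pmf (run_pmf S A n) \<rho>) = measure (run_pmf S A n) ?R"
    by (rule measure_measure_pmf_finite[symmetric]) (rule finR)
  also have "\<dots> = pmf (map_pmf (frun_trace S) (run_pmf S A n)) u"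
    by (subst pmf_map) (auto intro!: measure_pmf.finite_measure_eq_AE simp: AE_measure_pmf_iff)
  finally show ?thesis .
qed

text \<open>The empty prefix, which \<open>emeasure_trace_schedule\<close> leaves out.\<close>

lemma emeasure_run_measure_prefix_0:
  "is_pts P \<Longrightarrow> emeasure (run_measure P) {r \<in> runs P. prefix 0 (trace P r) = []} = 1"
  using prob_space.emeasure_space_1[OF prob_space_run_measure]
  by (simp add: space_run_measure)

lemma Disc_schedule_le:
  fixes S1 :: "('s::finite, 'a::countable) idtmc" and S2 :: "('t::finite, 'a) idtmc"
  assumes "\<And>n. map_pmf (frun_trace S1) (run_pmf S1 A1 n) = map_pmf (frun_trace S2) (run_pmf S2 A2 n)"
  shows "Disc (schedule S1 A1) O' \<phi> \<le> Disc (schedule S2 A2) O' \<phi>"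
proof (intro Disc_le is_pts_schedule)
  fix u :: "'a list"
  show "emeasure (run_measure (schedule S1 A1))
      {r \<in> runs (schedule S1 A1). prefix (length u) (trace (schedule S1 A1) r) = u} =
    emeasure (run_measure (schedule S2 A2))
      {r \<in> runs (schedule S2 A2). prefix (length u) (trace (schedule S2 A2) r) = u}"
  proof (cases u)
    case Nil
    then show ?thesis by (simp only: list.size emeasure_run_measure_prefix_0 is_pts_schedule)
  next
    case (Cons a v)
    then have "length u = Suc (length v)" by simp
    then show ?thesis by (simp only: emeasure_trace_schedule assms)
  qed
qed


section \<open>Transferring schedulers along a simulation\<close>

text \<open>One step of the coupling: a simulated run drawn from \<open>p\<close> moves by
  \<open>A\<close>, then \<open>\<delta>\<close>, chosen by the two current states, draws the new
  state of the simulating chain.\<close>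

definition joint_step ::
  "('s frun \<Rightarrow> 's pmf) \<Rightarrow> ('s \<Rightarrow> 't \<Rightarrow> 's \<Rightarrow> 't pmf) \<Rightarrow> 't \<Rightarrow> 's frun pmf \<Rightarrow> ('s frun \<times> 't) pmf"
  where "joint_step A \<delta> t p =
    p \<bind> (\<lambda>\<rho>. A \<rho> \<bind> (\<lambda>s. map_pmf (Pair (Ext \<rho> (A \<rho>) s)) (\<delta> (lst \<rho>) t s)))"

text \<open>
  The conditional distribution of the run of the simulated chain, given the run of the simulating
  chain. The distributions recorded in the latter play no role.
\<close>

primrec belief ::
  "'s \<Rightarrow> ('s frun \<Rightarrow> 's pmf) \<Rightarrow> ('s \<Rightarrow> 't \<Rightarrow> 's \<Rightarrow> 't pmf) \<Rightarrow> 't frun \<Rightarrow> 's frun pmf" where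
  "belief s0 A \<delta> (Init t) = return_pmf (Init s0)"
| "belief s0 A \<delta> (Ext \<rho> \<mu> t) =
    map_pmf fst (cond_pmf (joint_step A \<delta> (lst \<rho>) (belief s0 A \<delta> \<rho>)) {x. t = snd x})"

text \<open>The draw from \<open>\<delta>\<close> integrates out, so the simulated chain still moves
  by \<open>A\<close>.\<close>

lemma map_fst_joint_step:
  "map_pmf fst (joint_step A \<delta> t p) = p \<bind> (\<lambda>\<rho>. map_pmf (Ext \<rho> (A \<rho>)) (A \<rho>))"
  by (simp add: joint_step_def map_bind_pmf map_pmf_comp map_pmf_const) (simp add: map_pmf_def)

lemma set_joint_step:
  "set_pmf (joint_step A \<delta> t p) =
    {(Ext \<rho> (A \<rho>) s, t') | \<rho> s t'. \<rho> \<in> set_pmf p \<and> s \<in> set_pmf (A \<rho>) \<and> t' \<in> set_pmf (\<delta> (lst \<rho>) t s)}"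
  by (auto simp: joint_step_def)

text \<open>The law of total probability, conditioning on the second component.\<close>

lemma disintegrate_pmf:
  "map_pmf snd q \<bind> (\<lambda>t. map_pmf fst (cond_pmf q {x. t = snd x})) = map_pmf fst q"
proof -
  have "map_pmf snd q \<bind> (\<lambda>t. cond_pmf q {x. t = snd x}) = q"
    by (rule bind_cond_pmf_cancel) (auto simp: measure_map_pmf vimage_def eq_commute)
  then show ?thesis by (simp flip: map_bind_pmf)
qed

text \<open>The probability is a finite convex combination, with weights \<open>pmf p\<close>, of
  values in the convex set \<open>I\<close>.\<close>

lemma pmf_snd_joint_step_in_interval:
  fixes A :: "'s::finite frun \<Rightarrow> 's pmf" and \<delta> :: "'s \<Rightarrow> 't \<Rightarrow> 's \<Rightarrow> 't pmf"
  assumes fin: "finite (set_pmf p)" and I: "is_interval I"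
    and mem: "\<And>\<rho>. \<rho> \<in> set_pmf p \<Longrightarrow> (\<Sum>s\<in>UNIV. pmf (A \<rho>) s * pmf (\<delta> (lst \<rho>) t s) t') \<in> I"
  shows "pmf (map_pmf snd (joint_step A \<delta> t p)) t' \<in> I"
proof -
  have "map_pmf snd (joint_step A \<delta> t p) = p \<bind> (\<lambda>\<rho>. A \<rho> \<bind> (\<lambda>s. \<delta> (lst \<rho>) t s))"
    by (simp add: joint_step_def map_bind_pmf map_pmf_comp)
  then have "pmf (map_pmf snd (joint_step A \<delta> t p)) t' =
      (\<Sum>\<rho>\<in>set_pmf p. pmf p \<rho> * (\<Sum>s\<in>UNIV. pmf (A \<rho>) s * pmf (\<delta> (lst \<rho>) t s) t'))"
    by (simp add: pmf_bind integral_measure_pmf[OF fin] integral_measure_pmf[of UNIV])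
  also have "\<dots> \<in> I"
    using fin is_interval_convex[OF I] mem convex_sum[of "set_pmf p" I "pmf p"]
    by (simp add: sum_pmf_eq_1)
  finally show ?thesis .
qed

text \<open>Averaging the beliefs over the runs of the simulating chain returns the law of the
  simulated run, and every run in a belief has the trace of the history it is conditioned on. The
  two facts give equal trace laws.\<close>

lemma simulating_scheduler:
  fixes S1 :: "('s::finite, 'a) idtmc" and S2 :: "('t::finite, 'a) idtmc"
  assumes S2: "is_idtmc S2" and ne: "Sched S2 \<noteq> {}" and sim: "simulates S2 S1"
    and A1: "A1 \<in> Sched S1"
  shows "\<exists>A2\<in>Sched S2. \<forall>n.
    map_pmf (frun_trace S1) (run_pmf S1 A1 n) = map_pmf (frun_trace S2) (run_pmf S2 A2 n)"
proof -
  obtain A0 where A0: "A0 \<in> Sched S2" using ne by blast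
  obtain R :: "'s \<Rightarrow> 't \<Rightarrow> bool" where R: "R (init S1) (init S2)"
    "\<And>s1 s2. R s1 s2 \<Longrightarrow> lab S1 s1 = lab S2 s2"
    "\<And>s1 s2. R s1 s2 \<Longrightarrow> \<exists>\<delta> :: 's \<Rightarrow> 't pmf.
      (\<forall>f\<in>dists S1 s1. \<forall>s2'. (\<Sum>s1'\<in>UNIV. f s1' * pmf (\<delta> s1') s2') \<in> trans S2 s2 s2') \<and>
      (\<forall>s1' s2'. pmf (\<delta> s1') s2' > 0 \<longrightarrow> R s1' s2')"
    using sim unfolding simulates_def by blast
  from R(3) obtain \<delta> :: "'s \<Rightarrow> 't \<Rightarrow> 's \<Rightarrow> 't pmf" where
    \<delta>: "\<And>s1 s2 f s2'. R s1 s2 \<Longrightarrow> f \<in> dists S1 s1 \<Longrightarrow>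
        (\<Sum>s1'\<in>UNIV. f s1' * pmf (\<delta> s1 s2 s1') s2') \<in> trans S2 s2 s2'"
    and \<delta>R: "\<And>s1 s2 s1' s2'. R s1 s2 \<Longrightarrow> pmf (\<delta> s1 s2 s1') s2' > 0 \<Longrightarrow> R s1' s2'"
    by metis
  let ?B = "belief (init S1) A1 \<delta>"
  let ?J = "\<lambda>\<rho>. joint_step A1 \<delta> (lst \<rho>) (?B \<rho>)"
  \<comment> \<open>Membership in \<open>FRuns S1\<close> makes the choices of \<open>A1\<close>
    legal, \<open>R\<close> makes \<open>\<delta>\<close> applicable, and finiteness turns the
    average into a finite sum.\<close>
  define good where "good \<rho> \<longleftrightarrow> finite (set_pmf (?B \<rho>)) \<and>
    (\<forall>\<rho>1\<in>set_pmf (?B \<rho>). \<rho>1 \<in> FRuns S1 \<and> R (lst \<rho>1) (lst \<rho>))" for \<rho>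
  \<comment> \<open>A scheduler must be legal on all of \<open>FRuns S2\<close>, including histories
    with moves of probability \<open>0\<close>, where the conditioning in \<open>belief\<close> is
    unspecified; \<open>A0\<close> is the fallback.\<close>
  define A2 where "A2 \<rho> = (if good \<rho> then map_pmf snd (?J \<rho>) else A0 \<rho>)" for \<rho>
  have "A2 \<in> Sched S2"
    unfolding Sched_def
  proof (intro CollectI ballI allI)
    fix \<rho> t assume \<rho>: "\<rho> \<in> FRuns S2"
    show "pmf (A2 \<rho>) t \<in> trans S2 (lst \<rho>) t"
    proof (cases "good \<rho>")
      case True
      have "pmf (map_pmf snd (?J \<rho>)) t \<in> trans S2 (lst \<rho>) t"
      proof (rule pmf_snd_joint_step_in_interval)
        fix \<rho>1 assume "\<rho>1 \<in> set_pmf (?B \<rho>)"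
        then have "\<rho>1 \<in> FRuns S1" and R1: "R (lst \<rho>1) (lst \<rho>)" using True by (auto simp: good_def)
        then have "pmf (A1 \<rho>1) \<in> dists S1 (lst \<rho>1)"
          using A1 by (auto simp: dists_def Sched_def pmf_le_1 sum_pmf_eq_1)
        then show "(\<Sum>s\<in>UNIV. pmf (A1 \<rho>1) s * pmf (\<delta> (lst \<rho>1) (lst \<rho>) s) t) \<in> trans S2 (lst \<rho>) t"
          by (rule \<delta>[OF R1])
      qed (use True S2 in \<open>auto simp: good_def is_idtmc_def\<close>)
      then show ?thesis by (simp add: A2_def True)
    qed (use A0 \<rho> in \<open>auto simp: A2_def Sched_def\<close>)
  qed
  moreover have inv: "good \<rho> \<and> (\<forall>\<rho>1\<in>set_pmf (?B \<rho>). frun_trace S1 \<rho>1 = frun_trace S2 \<rho>)"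
    if "\<rho> \<in> set_pmf (run_pmf S2 A2 n)" for \<rho> n
    using that
  proof (induction n arbitrary: \<rho>)
    case 0
    then show ?case using R(1,2) by (auto simp: good_def intro: FRuns.intros)
  next
    case (Suc n)
    then obtain \<rho>' t where \<rho>: "\<rho> = Ext \<rho>' (A2 \<rho>') t" "\<rho>' \<in> set_pmf (run_pmf S2 A2 n)"
      "t \<in> set_pmf (A2 \<rho>')" by auto
    note IH = Suc.IH[OF \<rho>(2)]
    then have J: "t \<in> snd ` set_pmf (?J \<rho>')" using \<rho>(3) by (simp add: A2_def)
    \<comment> \<open>The move to \<open>t\<close> has positive probability, so
      \<open>cond_pmf\<close> is a genuine conditional distribution.\<close>
    then have "set_pmf (?J \<rho>') \<inter> {x. t = snd x} \<noteq> {}" by auto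
    then have B: "set_pmf (?B \<rho>) = fst ` (set_pmf (?J \<rho>') \<inter> {x. t = snd x})"
      unfolding \<rho>(1) by (simp add: set_cond_pmf)
    have "finite (set_pmf (?J \<rho>'))"
      using IH by (auto simp: joint_step_def good_def)
    then have "finite (set_pmf (?B \<rho>))" unfolding B by simp
    moreover have "\<rho>1 \<in> FRuns S1 \<and> R (lst \<rho>1) (lst \<rho>) \<and> frun_trace S1 \<rho>1 = frun_trace S2 \<rho>"
      if \<rho>1: "\<rho>1 \<in> set_pmf (?B \<rho>)" for \<rho>1
    proof -
      from \<rho>1 obtain \<rho>1' s where *: "\<rho>1 = Ext \<rho>1' (A1 \<rho>1') s" "\<rho>1' \<in> set_pmf (?B \<rho>')"
        "s \<in> set_pmf (A1 \<rho>1')" "t \<in> set_pmf (\<delta> (lst \<rho>1') (lst \<rho>') s)"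
        unfolding B set_joint_step by auto
      have F: "\<rho>1' \<in> FRuns S1" and R': "R (lst \<rho>1') (lst \<rho>')"
        and tr: "frun_trace S1 \<rho>1' = frun_trace S2 \<rho>'"
        using IH *(2) by (auto simp: good_def)
      have "R s t" using \<delta>R[OF R'] *(4) by (simp add: pmf_positive)
      moreover have "\<rho>1 \<in> FRuns S1"
        using F A1 unfolding *(1) by (intro FRuns.intros) (auto simp: Sched_def)
      ultimately show ?thesis using tr R(2) by (simp add: *(1) \<rho>(1))
    qed
    ultimately show ?case by (auto simp: good_def)
  qed
  have marginal: "run_pmf S2 A2 n \<bind> ?B = run_pmf S1 A1 n" for n
  proof (induction n)
    case 0
    show ?case by (simp add: bind_return_pmf)
  next
    case (Suc n)
    have "run_pmf S2 A2 (Suc n) \<bind> ?B =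
        run_pmf S2 A2 n \<bind> (\<lambda>\<rho>. A2 \<rho> \<bind> (\<lambda>t. ?B (Ext \<rho> (A2 \<rho>) t)))"
      by (simp add: bind_assoc_pmf bind_map_pmf)
    \<comment> \<open>\<open>A2\<close> draws the second marginal of the joint step and
      \<open>belief\<close> conditions on it, so together they yield the first marginal.\<close>
    also have "\<dots> = run_pmf S2 A2 n \<bind> (\<lambda>\<rho>. ?B \<rho> \<bind> (\<lambda>\<rho>1. map_pmf (Ext \<rho>1 (A1 \<rho>1)) (A1 \<rho>1)))"
    proof (rule bind_pmf_cong[OF refl])
      fix \<rho> assume "\<rho> \<in> set_pmf (run_pmf S2 A2 n)"
      then have "A2 \<rho> = map_pmf snd (?J \<rho>)" using inv by (simp add: A2_def)
      then show "A2 \<rho> \<bind> (\<lambda>t. ?B (Ext \<rho> (A2 \<rho>) t)) =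
          ?B \<rho> \<bind> (\<lambda>\<rho>1. map_pmf (Ext \<rho>1 (A1 \<rho>1)) (A1 \<rho>1))"
        by (simp only: belief.simps disintegrate_pmf map_fst_joint_step)
    qed
    also have "\<dots> = run_pmf S1 A1 (Suc n)"
      by (simp add: Suc bind_assoc_pmf[symmetric])
    finally show ?case .
  qed
  have "map_pmf (frun_trace S1) (run_pmf S1 A1 n) = map_pmf (frun_trace S2) (run_pmf S2 A2 n)" for n
  proof -
    have "map_pmf (frun_trace S1) (run_pmf S1 A1 n) =
        run_pmf S2 A2 n \<bind> (\<lambda>\<rho>. map_pmf (frun_trace S1) (?B \<rho>))"
      by (simp flip: marginal add: map_bind_pmf)
    also have "\<dots> = run_pmf S2 A2 n \<bind> (\<lambda>\<rho>. return_pmf (frun_trace S2 \<rho>))"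
    proof (rule bind_pmf_cong[OF refl])
      fix \<rho> assume "\<rho> \<in> set_pmf (run_pmf S2 A2 n)"
      then have "map_pmf (frun_trace S1) (?B \<rho>) = map_pmf (\<lambda>_. frun_trace S2 \<rho>) (?B \<rho>)"
        using inv by (intro map_pmf_cong) auto
      then show "map_pmf (frun_trace S1) (?B \<rho>) = return_pmf (frun_trace S2 \<rho>)"
        by simp
    qed
    finally show ?thesis by (simp add: map_pmf_def)
  qed
  ultimately show ?thesis by blast
qed

theorem theorem4p1:
  fixes S1 :: "('s::finite, 'a::finite) idtmc"
    and S2 :: "('t::finite, 'a) idtmc"
    and Ob :: "'a set"
    and \<phi> :: "'a word set"
  assumes "is_idtmc S1"
    and "is_idtmc S2"
    and "Sched S2 \<noteq> {}"
    and "omega_regular \<phi>"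
    and "simulates S2 S1"
  shows "Disc_sup S1 (obs Ob) \<phi> \<le> Disc_sup S2 (obs Ob) \<phi>"
  unfolding Disc_sup_def
proof (rule SUP_mono)
  \<comment> \<open>The suprema are compared scheduler by scheduler; a scheduler of
    \<open>S2\<close> exists by assumption and serves as the fallback in
    \<open>simulating_scheduler\<close>.\<close>
  fix A1 assume "A1 \<in> Sched S1"
  then obtain A2 where "A2 \<in> Sched S2" "\<And>n.
      map_pmf (frun_trace S1) (run_pmf S1 A1 n) = map_pmf (frun_trace S2) (run_pmf S2 A2 n)"
    using simulating_scheduler[OF assms(2,3,5)] by blast
  then show "\<exists>A2\<in>Sched S2. Disc (schedule S1 A1) (obs Ob) \<phi> \<le> Disc (schedule S2 A2) (obs Ob) \<phi>"
    using Disc_schedule_le by blast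
qed

end
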